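(* Let $\nu$ be a positive Borel measure on $\mathbb{R}^d$ with $\int(1\wedge|x|)\,\nu(\mathrm{d}x)<\infty$ and $\nu(\{0\})=0$. The space $$\mathrm{BV}_\nu(\mathbb{R}^d)=\Big\{u\in L^1(\mathbb{R}^d):\int_{\mathbb{R}^d}\int_{\mathbb{R}^d}|u(x+y)-u(y)|\,\nu(\mathrm{d}x)\,\mathrm{d}y<\infty\Big\}$$ equipped with the norm $\|u\|_{\mathrm{BV}_\nu}=\|u\|_{L^1}+\mathcal{F}_\nu(u)$ is a Banach space.
   Context: $a\wedge b=\min(a,b)$. $\mathcal{F}_\nu(u)=\frac12\int_{\mathbb{R}^d}\int_{\mathbb{R}^d}|u(x+y)-u(y)|\,\nu(\mathrm{d}x)\,\mathrm{d}y$. *)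

theory Defs
  imports "HOL-Analysis.Analysis"
begin

section \<open>The space $L^1$ of a Euclidean space\<close>

text \<open>
  Classes of Borel measurable Lebesgue-integrable functions modulo equality almost everywhere.
  Every class of Lebesgue measurable integrable functions contains a Borel representative, so
  these are the usual $L^1$ classes.
\<close>

definition L1_rel :: "('a::euclidean_space \<Rightarrow> real) \<Rightarrow> ('a \<Rightarrow> real) \<Rightarrow> bool" where
  "L1_rel u v \<longleftrightarrow> integrable lborel u \<and> integrable lborel v \<and> (AE x in lborel. u x = v x)"

lemma part_equivp_L1_rel: "part_equivp (L1_rel :: ('a::euclidean_space \<Rightarrow> real) \<Rightarrow> _)"
proof (rule part_equivpI)
  show "\<exists>u::'a \<Rightarrow> real. L1_rel u u"
    by (rule exI[of _ "\<lambda>_. 0"]) (simp add: L1_rel_def)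
  show "symp (L1_rel :: ('a \<Rightarrow> real) \<Rightarrow> _)"
    by (auto simp: symp_def L1_rel_def elim: eventually_mono)
  show "transp (L1_rel :: ('a \<Rightarrow> real) \<Rightarrow> _)"
  proof (rule transpI)
    fix u v w :: "'a \<Rightarrow> real"
    assume "L1_rel u v" "L1_rel v w"
    then show "L1_rel u w"
      unfolding L1_rel_def by (auto elim: eventually_elim2)
  qed
qed

quotient_type (overloaded) 'a L1 = "'a::euclidean_space \<Rightarrow> real" / partial: L1_rel
  morphisms rep_L1 abs_L1
  by (rule part_equivp_L1_rel)

lemma L1_rel_rep_L1: "L1_rel (rep_L1 U) (rep_L1 U)"
  by (rule Quotient3_rep_reflp[OF Quotient3_L1])

lemma integrable_rep_L1: "integrable lborel (rep_L1 U)"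
  using L1_rel_rep_L1[of U] by (simp add: L1_rel_def)

lemma rep_abs_L1:
  assumes "integrable lborel u"
  shows "AE x in lborel. rep_L1 (abs_L1 u) x = u x"
  using rep_abs_rsp_left[OF Quotient3_L1, of u u] assms by (simp add: L1_rel_def)

lemma abs_rep_L1: "abs_L1 (rep_L1 U) = U"
  by (rule Quotient3_abs_rep[OF Quotient3_L1])

instantiation L1 :: (euclidean_space) real_normed_vector
begin

lift_definition zero_L1 :: "'a L1" is "\<lambda>_. 0"
  by (simp add: L1_rel_def)

lift_definition plus_L1 :: "'a L1 \<Rightarrow> 'a L1 \<Rightarrow> 'a L1" is "\<lambda>u v x. u x + v x"
  by (auto simp: L1_rel_def elim: eventually_elim2)

lift_definition minus_L1 :: "'a L1 \<Rightarrow> 'a L1 \<Rightarrow> 'a L1" is "\<lambda>u v x. u x - v x"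
  by (auto simp: L1_rel_def elim: eventually_elim2)

lift_definition uminus_L1 :: "'a L1 \<Rightarrow> 'a L1" is "\<lambda>u x. - u x"
  by (auto simp: L1_rel_def elim: eventually_mono)

lift_definition scaleR_L1 :: "real \<Rightarrow> 'a L1 \<Rightarrow> 'a L1" is "\<lambda>c u x. c * u x"
  by (auto simp: L1_rel_def elim: eventually_mono)

lift_definition norm_L1 :: "'a L1 \<Rightarrow> real" is "\<lambda>u. LINT x|lborel. \<bar>u x\<bar>"
  by (rule integral_cong_AE) (auto simp: L1_rel_def elim: eventually_mono)

definition dist_L1 :: "'a L1 \<Rightarrow> 'a L1 \<Rightarrow> real" where
  "dist_L1 U V = norm (U - V)"

definition sgn_L1 :: "'a L1 \<Rightarrow> 'a L1" where
  "sgn_L1 U = scaleR (inverse (norm U)) U"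

definition uniformity_L1 :: "('a L1 \<times> 'a L1) filter" where
  "uniformity_L1 = (INF e\<in>{0<..}. principal {(U, V). dist U V < e})"

definition open_L1 :: "'a L1 set \<Rightarrow> bool" where
  "open_L1 S \<longleftrightarrow> (\<forall>U\<in>S. \<forall>\<^sub>F (U', V) in uniformity. U' = U \<longrightarrow> V \<in> S)"

instance
proof
  fix U V W :: "'a L1" and a b :: real
  show "U + V + W = U + (V + W)"
    by transfer (auto simp: L1_rel_def add.assoc)
  show "U + V = V + U"
    by transfer (auto simp: L1_rel_def add.commute)
  show "0 + U = U"
    by transfer (auto simp: L1_rel_def)
  show "- U + U = 0"
    by transfer (auto simp: L1_rel_def)
  show "U - V = U + - V"
    by transfer (auto simp: L1_rel_def)
  show "a *\<^sub>R (U + V) = a *\<^sub>R U + a *\<^sub>R V"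
    by transfer (auto simp: L1_rel_def algebra_simps)
  show "(a + b) *\<^sub>R U = a *\<^sub>R U + b *\<^sub>R U"
    by transfer (auto simp: L1_rel_def algebra_simps)
  show "a *\<^sub>R b *\<^sub>R U = (a * b) *\<^sub>R U"
    by transfer (auto simp: L1_rel_def algebra_simps)
  show "1 *\<^sub>R U = U"
    by transfer (auto simp: L1_rel_def)
  show "dist U V = norm (U - V)"
    by (rule dist_L1_def)
  show "sgn U = scaleR (inverse (norm U)) U"
    by (rule sgn_L1_def)
  show "uniformity = (INF e\<in>{0<..}. principal {(U::'a L1, V). dist U V < e})"
    by (rule uniformity_L1_def)
  show "open S \<longleftrightarrow> (\<forall>U\<in>S. \<forall>\<^sub>F (U', V) in uniformity. U' = U \<longrightarrow> V \<in> S)" for S :: "'a L1 set"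
    by (rule open_L1_def)
  show "norm U = 0 \<longleftrightarrow> U = 0"
    by transfer (auto simp: L1_rel_def integral_nonneg_eq_0_iff_AE)
  show "norm (U + V) \<le> norm U + norm V"
  proof transfer
    fix u v :: "'a \<Rightarrow> real"
    assume "L1_rel u u" "L1_rel v v"
    then have uv: "integrable lborel u" "integrable lborel v"
      by (auto simp: L1_rel_def)
    have "(LINT x|lborel. \<bar>u x + v x\<bar>) \<le> (LINT x|lborel. \<bar>u x\<bar> + \<bar>v x\<bar>)"
      by (rule integral_mono) (use uv in auto)
    also have "\<dots> = (LINT x|lborel. \<bar>u x\<bar>) + (LINT x|lborel. \<bar>v x\<bar>)"
      by (rule Bochner_Integration.integral_add) (use uv in auto)
    finally show "(LINT x|lborel. \<bar>u x + v x\<bar>) \<le> (LINT x|lborel. \<bar>u x\<bar>) + (LINT x|lborel. \<bar>v x\<bar>)" .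
  qed
  show "norm (a *\<^sub>R U) = \<bar>a\<bar> * norm U"
    by transfer (simp add: abs_mult)
qed

end

section \<open>Banach spaces carried by a subset of a vector space\<close>

definition norm_on :: "'v::real_vector set \<Rightarrow> ('v \<Rightarrow> real) \<Rightarrow> bool" where
  "norm_on S N \<longleftrightarrow>
     (\<forall>x\<in>S. 0 \<le> N x) \<and>
     (\<forall>x\<in>S. N x = 0 \<longleftrightarrow> x = 0) \<and>
     (\<forall>x\<in>S. \<forall>c. N (c *\<^sub>R x) = \<bar>c\<bar> * N x) \<and>
     (\<forall>x\<in>S. \<forall>y\<in>S. N (x + y) \<le> N x + N y)"

definition complete_norm_on :: "'v::real_vector set \<Rightarrow> ('v \<Rightarrow> real) \<Rightarrow> bool" where
  "complete_norm_on S N \<longleftrightarrow>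
     (\<forall>X. (\<forall>n::nat. X n \<in> S) \<longrightarrow>
          (\<forall>\<epsilon>>0. \<exists>M. \<forall>m\<ge>M. \<forall>n\<ge>M. N (X m - X n) < \<epsilon>) \<longrightarrow>
          (\<exists>x\<in>S. (\<lambda>n. N (X n - x)) \<longlonglongrightarrow> 0))"

definition banach_space_on :: "'v::real_vector set \<Rightarrow> ('v \<Rightarrow> real) \<Rightarrow> bool" where
  "banach_space_on S N \<longleftrightarrow> subspace S \<and> norm_on S N \<and> complete_norm_on S N"

section \<open>Functions of bounded nonlocal variation\<close>

definition BV_nu_integral ::
    "'a::euclidean_space measure \<Rightarrow> ('a \<Rightarrow> real) \<Rightarrow> ennreal" where
  "BV_nu_integral \<nu> u = (\<integral>\<^sup>+ y. (\<integral>\<^sup>+ x. ennreal \<bar>u (x + y) - u y\<bar> \<partial>\<nu>) \<partial>lborel)"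

definition F_nu :: "'a::euclidean_space measure \<Rightarrow> ('a \<Rightarrow> real) \<Rightarrow> ennreal" where
  "F_nu \<nu> u = (1 / 2) * BV_nu_integral \<nu> u"

text \<open>
  The following two definitions evaluate the functional at a chosen representative of the
  class; the choice is immaterial by \<open>BV_nu_integral_cong_AE\<close>.
\<close>

definition BV_nu :: "'a::euclidean_space measure \<Rightarrow> 'a L1 set" where
  "BV_nu \<nu> = {U. BV_nu_integral \<nu> (rep_L1 U) < \<infinity>}"

definition BV_nu_norm :: "'a::euclidean_space measure \<Rightarrow> 'a L1 \<Rightarrow> real" where
  "BV_nu_norm \<nu> U = norm U + enn2real (F_nu \<nu> (rep_L1 U))"

lemma sigma_finite_of_finite_moment:
  fixes \<nu> :: "'a::euclidean_space measure"
  assumes sets: "sets \<nu> = sets borel"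
    and fin: "(\<integral>\<^sup>+ x. ennreal (min 1 (norm x)) \<partial>\<nu>) < \<infinity>"
    and zero: "emeasure \<nu> {0} = 0"
  shows "sigma_finite_measure \<nu>"
proof
  have sp: "space \<nu> = UNIV"
    using sets_eq_imp_space_eq[OF sets] by simp
  have meas: "(\<lambda>x::'a. ennreal (min 1 (norm x))) \<in> borel_measurable \<nu>"
    by (subst measurable_cong_sets[OF sets refl]) measurable
  define A where "A n = {x::'a. 1 \<le> of_nat (Suc n) * ennreal (min 1 (norm x))}" for n
  have A_sets: "A n \<in> sets \<nu>" for n
    unfolding A_def sets by measurable
  have "emeasure \<nu> (A n) \<noteq> \<infinity>" for n
  proof -
    have "emeasure \<nu> (A n) \<le> of_nat (Suc n) * (\<integral>\<^sup>+ x. ennreal (min 1 (norm x)) * indicator UNIV x \<partial>\<nu>)"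
      using nn_integral_Markov_inequality[of "\<lambda>x. ennreal (min 1 (norm x))" UNIV \<nu> "of_nat (Suc n)"]
        meas by (simp add: A_def sets del: of_nat_Suc)
    also have "\<dots> < \<infinity>"
      using fin by (simp add: sp ennreal_mult_less_top of_nat_less_top)
    finally show ?thesis by simp
  qed
  moreover
  have "x \<in> {0} \<union> (\<Union>n. A n)" for x :: 'a
  proof (cases "x = 0")
    case False
    then have "0 < min 1 (norm x)" by simp
    then obtain n where "inverse (of_nat (Suc n)) < min 1 (norm x)"
      using reals_Archimedean by blast
    then have "1 \<le> real (Suc n) * min 1 (norm x)"
      by (auto simp: field_simps min_def simp del: of_nat_Suc)
    then have "ennreal 1 \<le> ennreal (real (Suc n) * min 1 (norm x))"
      by (rule ennreal_leI)
    then have "x \<in> A n"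
      by (simp add: A_def ennreal_mult ennreal_of_nat_eq_real_of_nat del: of_nat_Suc)
    then show ?thesis by blast
  qed simp
  then have "\<Union> (insert {0} (range A)) = UNIV"
    by blast
  ultimately show "\<exists>B. countable B \<and> B \<subseteq> sets \<nu> \<and> \<Union> B = space \<nu> \<and> (\<forall>a\<in>B. emeasure \<nu> a \<noteq> \<infinity>)"
    using A_sets zero by (intro exI[of _ "insert {0} (range A)"] conjI) (simp_all add: sp sets image_subset_iff)
qed

lemma BV_nu_integral_cong_AE:
  fixes \<nu> :: "'a::euclidean_space measure"
  assumes sets: "sets \<nu> = sets borel"
    and "(\<integral>\<^sup>+ x. ennreal (min 1 (norm x)) \<partial>\<nu>) < \<infinity>"
    and "emeasure \<nu> {0} = 0"
    and uv: "L1_rel u v"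
  shows "BV_nu_integral \<nu> u = BV_nu_integral \<nu> v"
proof -
  interpret \<nu>: sigma_finite_measure \<nu>
    using assms by (intro sigma_finite_of_finite_moment)
  interpret pair_sigma_finite \<nu> lborel ..
  have swap: "BV_nu_integral \<nu> w =
      (\<integral>\<^sup>+ x. (\<integral>\<^sup>+ y. ennreal \<bar>w (x + y) - w y\<bar> \<partial>lborel) \<partial>\<nu>)"
    if "w \<in> borel_measurable borel" for w
  proof -
    note [measurable_cong] = sets
    note [measurable] = that
    show ?thesis
      unfolding BV_nu_integral_def
      by (rule Fubini'[of "\<lambda>x y. ennreal \<bar>w (x + y) - w y\<bar>"]) measurable
  qed
  have b: "u \<in> borel_measurable borel" "v \<in> borel_measurable borel"
    and ae: "AE y in lborel. u y = v y"
    using uv by (auto simp: L1_rel_def dest: borel_measurable_integrable)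
  have "(\<integral>\<^sup>+ y. ennreal \<bar>u (x + y) - u y\<bar> \<partial>lborel) = (\<integral>\<^sup>+ y. ennreal \<bar>v (x + y) - v y\<bar> \<partial>lborel)" for x
  proof (rule nn_integral_cong_AE)
    have P: "Measurable.pred borel (\<lambda>y. u y = v y)"
      using b by measurable
    have "AE y in distr lborel borel ((+) x). u y = v y"
      by (subst lborel_distr_plus) (rule ae)
    then have "AE y in lborel. u (x + y) = v (x + y)"
      by (subst (asm) AE_distr_iff) (use P in auto)
    with ae show "AE y in lborel. ennreal \<bar>u (x + y) - u y\<bar> = ennreal \<bar>v (x + y) - v y\<bar>"
      by eventually_elim simp
  qed
  then show ?thesis
    using b by (simp add: swap)
qed

lemma
  fixes \<nu> :: "'a::euclidean_space measure"
  assumes "sets \<nu> = sets borel"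
    and "(\<integral>\<^sup>+ x. ennreal (min 1 (norm x)) \<partial>\<nu>) < \<infinity>"
    and "emeasure \<nu> {0} = 0"
    and u: "integrable lborel u"
  shows abs_L1_in_BV_nu_iff: "abs_L1 u \<in> BV_nu \<nu> \<longleftrightarrow> BV_nu_integral \<nu> u < \<infinity>"
    and BV_nu_norm_abs_L1:
      "BV_nu_norm \<nu> (abs_L1 u) = (LINT x|lborel. \<bar>u x\<bar>) + enn2real (F_nu \<nu> u)"
proof -
  have "L1_rel (rep_L1 (abs_L1 u)) u"
    using u integrable_rep_L1 rep_abs_L1 by (auto simp: L1_rel_def)
  then have eq: "BV_nu_integral \<nu> (rep_L1 (abs_L1 u)) = BV_nu_integral \<nu> u"
    using assms by (intro BV_nu_integral_cong_AE)
  then show "abs_L1 u \<in> BV_nu \<nu> \<longleftrightarrow> BV_nu_integral \<nu> u < \<infinity>"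
    by (simp add: BV_nu_def)
  have "norm (abs_L1 u) = (LINT x|lborel. \<bar>u x\<bar>)"
    using u by (intro norm_L1.abs_eq) (simp add: L1_rel_def)
  with eq show "BV_nu_norm \<nu> (abs_L1 u) = (LINT x|lborel. \<bar>u x\<bar>) + enn2real (F_nu \<nu> u)"
    by (simp add: BV_nu_norm_def F_nu_def)
qed

end

theory Submission
  imports Defs
begin

text \<open>
  The functional \<open>BV_nu_integral \<nu>\<close> is an extended seminorm on $L^1$, and by Fatou's lemma,
  applied first on translates and then with respect to \<open>\<nu>\<close>, it is lower semicontinuous for
  $L^1$ convergence. A Cauchy sequence $X_n$ of the BV norm therefore has an $L^1$ limit $U$, and
  the seminorm of $X_n - U$ is at most the limes inferior over $m$ of the seminorms of $X_n - X_m$,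
  which is small for large $n$.
\<close>

section \<open>Representatives of $L^1$ classes and the $L^1$ norm\<close>

lemma borel_measurable_rep_L1 [measurable]: "rep_L1 U \<in> borel_measurable borel"
  using borel_measurable_integrable[OF integrable_rep_L1[of U]] by simp

lemma L1_rel_rep_abs:
  assumes "integrable lborel u"
  shows "L1_rel (rep_L1 (abs_L1 u)) u"
  using assms integrable_rep_L1 rep_abs_L1 by (auto simp: L1_rel_def)

text \<open>\<open>rep_L1\<close> picks an arbitrary representative, so it commutes with the vector
  operations only up to a null set; hence \<open>L1_rel\<close> in place of equality, here and in
  the next two lemmas.\<close>

lemma L1_rel_rep_add: "L1_rel (rep_L1 (U + V)) (\<lambda>x. rep_L1 U x + rep_L1 V x)"
proof -
  have "U + V = abs_L1 (\<lambda>x. rep_L1 U x + rep_L1 V x)"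
    using plus_L1.abs_eq[OF L1_rel_rep_L1[of U] L1_rel_rep_L1[of V]] by (simp add: abs_rep_L1)
  then show ?thesis
    by (simp add: L1_rel_rep_abs integrable_rep_L1)
qed

lemma L1_rel_rep_diff: "L1_rel (rep_L1 (U - V)) (\<lambda>x. rep_L1 U x - rep_L1 V x)"
proof -
  have "U - V = abs_L1 (\<lambda>x. rep_L1 U x - rep_L1 V x)"
    using minus_L1.abs_eq[OF L1_rel_rep_L1[of U] L1_rel_rep_L1[of V]] by (simp add: abs_rep_L1)
  then show ?thesis
    by (simp add: L1_rel_rep_abs integrable_rep_L1)
qed

lemma L1_rel_rep_scaleR: "L1_rel (rep_L1 (c *\<^sub>R U)) (\<lambda>x. c * rep_L1 U x)"
proof -
  have "c *\<^sub>R U = abs_L1 (\<lambda>x. c * rep_L1 U x)"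
    using scaleR_L1.abs_eq[OF L1_rel_rep_L1[of U]] by (simp add: abs_rep_L1)
  then show ?thesis
    by (simp add: L1_rel_rep_abs integrable_rep_L1)
qed

lemma norm_L1_eq: "norm U = (LINT x|lborel. \<bar>rep_L1 U x\<bar>)"
  using norm_L1.abs_eq[OF L1_rel_rep_L1[of U]] by (simp add: abs_rep_L1)

lemma ennreal_norm_L1_eq: "ennreal (norm U) = (\<integral>\<^sup>+ x. ennreal \<bar>rep_L1 U x\<bar> \<partial>lborel)"
  unfolding norm_L1_eq
  by (rule nn_integral_eq_integral[symmetric]) (auto simp: integrable_rep_L1)

text \<open>Any representative computes the norm. In \<open>ennreal\<close> form, Fatou and the
  exchange of sum and integral apply without integrability side conditions.\<close>

lemma ennreal_norm_L1_eq_rel: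
  assumes "L1_rel (rep_L1 U) u"
  shows "ennreal (norm U) = (\<integral>\<^sup>+ x. ennreal \<bar>u x\<bar> \<partial>lborel)"
  unfolding ennreal_norm_L1_eq
  by (rule nn_integral_cong_AE) (use assms in \<open>auto simp: L1_rel_def elim: eventually_mono\<close>)

section \<open>Completeness of $L^1$ (Riesz-Fischer)\<close>

text \<open>The integral of the summed absolute increments equals the sum of their norms, which is
  finite. So the increments are absolutely summable at almost every point, and their partial sums
  telescope.\<close>

lemma L1_AE_convergent_of_summable:
  fixes Y :: "nat \<Rightarrow> 'a::euclidean_space L1"
  assumes "summable (\<lambda>k. norm (Y (Suc k) - Y k))"
  shows "AE x in lborel. convergent (\<lambda>k. rep_L1 (Y k) x)"
proof -
  let ?d = "\<lambda>k x. \<bar>rep_L1 (Y (Suc k)) x - rep_L1 (Y k) x\<bar>"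
  have "(\<integral>\<^sup>+ x. (\<Sum>k. ennreal (?d k x)) \<partial>lborel) = (\<Sum>k. \<integral>\<^sup>+ x. ennreal (?d k x) \<partial>lborel)"
    by (rule nn_integral_suminf) measurable
  also have "\<dots> = (\<Sum>k. ennreal (norm (Y (Suc k) - Y k)))"
    by (simp add: ennreal_norm_L1_eq_rel[OF L1_rel_rep_diff])
  also have "\<dots> \<noteq> \<infinity>"
    using assms by (simp add: suminf_ennreal2)
  finally have "AE x in lborel. (\<Sum>k. ennreal (?d k x)) \<noteq> \<infinity>"
    by (intro nn_integral_PInf_AE) auto
  then show ?thesis
  proof eventually_elim
    case (elim x)
    then have "summable (\<lambda>k. ?d k x)"
      by (intro summable_suminf_not_top) auto
    then have "summable (\<lambda>k. rep_L1 (Y (Suc k)) x - rep_L1 (Y k) x)"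
      by (rule summable_rabs_cancel)
    then have "convergent (\<lambda>n. (\<Sum>k<n. rep_L1 (Y (Suc k)) x - rep_L1 (Y k) x) + rep_L1 (Y 0) x)"
      by (intro convergent_add convergent_const) (simp add: summable_iff_convergent)
    then show ?case
      by (simp add: sum_lessThan_telescope[of "\<lambda>k. rep_L1 (Y k) x"])
  qed
qed

text \<open>A rapidly Cauchy subsequence has a pointwise limit a.e.; Fatou turns the Cauchy
  estimates into norm estimates against that limit for the whole sequence.\<close>

lemma L1_Cauchy_convergent:
  fixes X :: "nat \<Rightarrow> 'a::euclidean_space L1"
  assumes "Cauchy X"
  shows "convergent X"
proof -
  have "\<exists>M. \<forall>m\<ge>M. \<forall>n\<ge>M. norm (X m - X n) < (1 / 2) ^ k" for k :: nat
    using CauchyD[OF assms, of "(1 / 2) ^ k"] by simp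
  then obtain M where M: "\<And>k m n. m \<ge> M k \<Longrightarrow> n \<ge> M k \<Longrightarrow> norm (X m - X n) < (1 / 2) ^ k"
    by metis
  \<comment> \<open>The sum dominates \<open>M k\<close> and is monotone in \<open>k\<close>, so
    consecutive terms of \<open>Y\<close> differ by less than \<open>(1 / 2) ^ k\<close>; the
    summand \<open>k\<close> forces \<open>r k\<close> to infinity.\<close>
  define r where "r k = k + (\<Sum>i\<le>k. M i)" for k
  have r_ge: "M k \<le> r k" "k \<le> r k" and r_mono: "r k \<le> r (Suc k)" for k
    using member_le_sum[of k "{..k}" M] by (auto simp: r_def)
  define Y where "Y k = X (r k)" for k
  have "summable (\<lambda>k. norm (Y (Suc k) - Y k))"
  proof (rule summable_comparison_test')
    show "summable (\<lambda>k. (1 / 2 :: real) ^ k)"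
      by (rule summable_geometric) simp
    show "norm (norm (Y (Suc k) - Y k)) \<le> (1 / 2) ^ k" if "k \<ge> 0" for k
      unfolding Y_def using M[of k "r (Suc k)" "r k"] r_ge(1)[of k] r_mono[of k] by simp
  qed
  note conv = L1_AE_convergent_of_summable[OF this]
  \<comment> \<open>Where the sequence diverges, \<open>lim\<close> has an unspecified value; this
    concerns a null set only.\<close>
  define u where "u x = lim (\<lambda>k. rep_L1 (Y k) x)" for x
  have [measurable]: "u \<in> borel_measurable borel"
    unfolding u_def by measurable
  \<comment> \<open>Stated in \<open>ennreal\<close> because \<open>u\<close> is not yet known to be
    integrable. It serves twice: once to obtain integrability, once to obtain convergence.\<close>
  have bound: "(\<integral>\<^sup>+ x. ennreal \<bar>rep_L1 (X n) x - u x\<bar> \<partial>lborel) \<le> ennreal e"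
    if e: "\<And>m. m \<ge> n \<Longrightarrow> norm (X n - X m) \<le> e" for n e
  proof -
    have "(\<integral>\<^sup>+ x. ennreal \<bar>rep_L1 (X n) x - u x\<bar> \<partial>lborel)
        = (\<integral>\<^sup>+ x. liminf (\<lambda>k. ennreal \<bar>rep_L1 (X n) x - rep_L1 (Y k) x\<bar>) \<partial>lborel)"
    proof (rule nn_integral_cong_AE, use conv in eventually_elim)
      case (elim x)
      then have "(\<lambda>k. rep_L1 (Y k) x) \<longlonglongrightarrow> u x"
        by (simp add: convergent_LIMSEQ_iff u_def)
      then have "(\<lambda>k. ennreal \<bar>rep_L1 (X n) x - rep_L1 (Y k) x\<bar>)
          \<longlonglongrightarrow> ennreal \<bar>rep_L1 (X n) x - u x\<bar>"
        by (intro tendsto_intros)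
      then show ?case
        by (intro lim_imp_Liminf[symmetric]) auto
    qed
    also have "\<dots> \<le> liminf (\<lambda>k. \<integral>\<^sup>+ x. ennreal \<bar>rep_L1 (X n) x - rep_L1 (Y k) x\<bar> \<partial>lborel)"
      by (rule nn_integral_liminf) measurable
    also have "\<dots> = liminf (\<lambda>k. ennreal (norm (X n - Y k)))"
      by (simp add: ennreal_norm_L1_eq_rel[OF L1_rel_rep_diff])
    also have "\<dots> \<le> liminf (\<lambda>k. ennreal e)"
    proof (rule Liminf_mono)
      show "\<forall>\<^sub>F k in sequentially. ennreal (norm (X n - Y k)) \<le> ennreal e"
        using eventually_ge_at_top[of n]
        by eventually_elim (use r_ge(2) e in \<open>auto simp: Y_def intro!: ennreal_leI intro: order_trans\<close>)
    qed
    also have "\<dots> = ennreal e"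
      by (simp add: Liminf_const)
    finally show ?thesis .
  qed
  \<comment> \<open>Since \<open>(1 / 2) ^ 0 = 1\<close>, the index \<open>M 0\<close> gives a term
    at finite distance from \<open>u\<close>; then \<open>u\<close> is a difference of two
    integrable functions.\<close>
  have "norm (X (M 0) - X m) \<le> 1" if "m \<ge> M 0" for m
    using M[of 0 "M 0" m] that by simp
  then have "(\<integral>\<^sup>+ x. ennreal \<bar>rep_L1 (X (M 0)) x - u x\<bar> \<partial>lborel) < \<infinity>"
    by (intro le_less_trans[OF bound[of "M 0" 1]]) auto
  then have "integrable lborel (\<lambda>x. rep_L1 (X (M 0)) x - u x)"
    by (intro integrableI_bounded) auto
  from Bochner_Integration.integrable_diff[OF integrable_rep_L1[of "X (M 0)"] this]
  have u: "integrable lborel u"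
    by simp
  define U where "U = abs_L1 u"
  have U: "L1_rel (rep_L1 (X n - U)) (\<lambda>x. rep_L1 (X n) x - u x)" for n
    using L1_rel_rep_diff[of "X n" U] L1_rel_rep_abs[OF u]
    unfolding L1_rel_def U_def by (auto simp: u integrable_rep_L1 elim: eventually_elim2)
  have "X \<longlonglongrightarrow> U"
  proof (rule metric_LIMSEQ_I)
    fix e :: real assume "0 < e"
    then obtain K where K: "\<And>m n. m \<ge> K \<Longrightarrow> n \<ge> K \<Longrightarrow> norm (X m - X n) < e / 2"
      using CauchyD[OF assms, of "e / 2"] by auto
    have "norm (X n - U) < e" if "n \<ge> K" for n
    proof -
      have "ennreal (norm (X n - U)) \<le> ennreal (e / 2)"
        unfolding ennreal_norm_L1_eq_rel[OF U] using K that by (intro bound less_imp_le) auto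
      then show ?thesis
        using \<open>0 < e\<close> by simp
    qed
    then show "\<exists>no. \<forall>n\<ge>no. dist (X n) U < e"
      by (auto simp: dist_norm)
  qed
  then show ?thesis
    by (rule convergentI)
qed

instance L1 :: (euclidean_space) banach
  by standard (rule L1_Cauchy_convergent)

text \<open>Norm convergence gives a.e. convergence only along a subsequence; this suffices for
  bounds that hold eventually.\<close>

lemma L1_tendsto_AE_subseq:
  fixes X :: "nat \<Rightarrow> 'a::euclidean_space L1"
  assumes "X \<longlonglongrightarrow> U"
  obtains r :: "nat \<Rightarrow> nat" where "strict_mono r"
    "AE x in lborel. (\<lambda>k. rep_L1 (X (r k)) x) \<longlonglongrightarrow> rep_L1 U x"
proof -
  have "(\<lambda>n. norm (X n - U)) \<longlonglongrightarrow> 0"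
    using assms by (simp add: LIM_zero_iff tendsto_norm_zero_iff)
  moreover have "norm (X n - U) = (LINT x|lborel. norm (rep_L1 (X n) x - rep_L1 U x))" for n
    unfolding norm_L1_eq using L1_rel_rep_diff[of "X n" U]
    by (intro integral_cong_AE) (auto simp: L1_rel_def elim: eventually_mono)
  ultimately have "(\<lambda>n. LINT x|lborel. norm (rep_L1 (X n) x - rep_L1 U x)) \<longlonglongrightarrow> 0"
    by simp
  from tendsto_L1_AE_subseq[OF _ this] show ?thesis
    using that by (auto simp: integrable_rep_L1 LIM_zero_iff)
qed

section \<open>The nonlocal variation as a lower semicontinuous seminorm\<close>

context
  fixes \<nu> :: "'a::euclidean_space measure"
  assumes sets_nu: "sets \<nu> = sets borel"
    and moment: "(\<integral>\<^sup>+ x. ennreal (min 1 (norm x)) \<partial>\<nu>) < \<infinity>"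
    and zero: "emeasure \<nu> {0} = 0"
begin

interpretation \<nu>: sigma_finite_measure \<nu>
  using sets_nu moment zero by (rule sigma_finite_of_finite_moment)

interpretation pair_sigma_finite \<nu> lborel ..

declare sets_nu [measurable_cong]

text \<open>Tonelli, by sigma-finiteness of \<open>\<nu>\<close>. With \<open>lborel\<close> inside,
  the shift \<open>x\<close> is fixed during the inner integration, so null sets in \<open>y\<close>
  may depend on \<open>x\<close>.\<close>

lemma BV_nu_integral_swap:
  assumes [measurable]: "w \<in> borel_measurable borel"
  shows "BV_nu_integral \<nu> w = (\<integral>\<^sup>+ x. (\<integral>\<^sup>+ y. ennreal \<bar>w (x + y) - w y\<bar> \<partial>lborel) \<partial>\<nu>)"
  unfolding BV_nu_integral_def
  by (rule Fubini'[of "\<lambda>x y. ennreal \<bar>w (x + y) - w y\<bar>"]) measurable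

lemma BV_nu_integral_add_le:
  assumes [measurable]: "u \<in> borel_measurable borel" "v \<in> borel_measurable borel"
  shows "BV_nu_integral \<nu> (\<lambda>x. u x + v x) \<le> BV_nu_integral \<nu> u + BV_nu_integral \<nu> v"
proof -
  have "BV_nu_integral \<nu> (\<lambda>x. u x + v x)
      \<le> (\<integral>\<^sup>+ y. (\<integral>\<^sup>+ x. ennreal \<bar>u (x + y) - u y\<bar> + ennreal \<bar>v (x + y) - v y\<bar> \<partial>\<nu>) \<partial>lborel)"
    unfolding BV_nu_integral_def
    by (intro nn_integral_mono) (simp flip: ennreal_plus add: ennreal_leI)
  also have "\<dots> = BV_nu_integral \<nu> u + BV_nu_integral \<nu> v"
    unfolding BV_nu_integral_def by (simp add: nn_integral_add)
  finally show ?thesis .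
qed

lemma BV_nu_integral_scale:
  assumes [measurable]: "u \<in> borel_measurable borel"
  shows "BV_nu_integral \<nu> (\<lambda>x. c * u x) = ennreal \<bar>c\<bar> * BV_nu_integral \<nu> u"
  unfolding BV_nu_integral_def
  by (simp add: abs_mult ennreal_mult nn_integral_cmult flip: right_diff_distrib)

text \<open>Fatou in \<open>y\<close> for each fixed shift \<open>x\<close>, then Fatou in
  \<open>x\<close> with respect to \<open>\<nu>\<close>.\<close>

lemma BV_nu_integral_le_liminf:
  assumes [measurable]: "\<And>k. w k \<in> borel_measurable borel" "u \<in> borel_measurable borel"
    and ae: "AE y in lborel. (\<lambda>k. w k y) \<longlonglongrightarrow> u y"
  shows "BV_nu_integral \<nu> u \<le> liminf (\<lambda>k. BV_nu_integral \<nu> (w k))"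
proof -
  have inner: "(\<integral>\<^sup>+ y. ennreal \<bar>u (x + y) - u y\<bar> \<partial>lborel)
      \<le> liminf (\<lambda>k. \<integral>\<^sup>+ y. ennreal \<bar>w k (x + y) - w k y\<bar> \<partial>lborel)" for x
  proof -
    \<comment> \<open>Lebesgue measure is translation invariant, so the exceptional set stays null
      after the shift by \<open>x\<close>.\<close>
    have "AE y in distr lborel borel ((+) x). (\<lambda>k. w k y) \<longlonglongrightarrow> u y"
      by (subst lborel_distr_plus) (rule ae)
    then have "AE y in lborel. (\<lambda>k. w k (x + y)) \<longlonglongrightarrow> u (x + y)"
      by (subst (asm) AE_distr_iff) auto
    with ae have "AE y in lborel. ennreal \<bar>u (x + y) - u y\<bar>
        = liminf (\<lambda>k. ennreal \<bar>w k (x + y) - w k y\<bar>)"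
    proof eventually_elim
      case (elim y)
      then have "(\<lambda>k. ennreal \<bar>w k (x + y) - w k y\<bar>) \<longlonglongrightarrow> ennreal \<bar>u (x + y) - u y\<bar>"
        by (intro tendsto_intros)
      then show ?case
        by (intro lim_imp_Liminf[symmetric]) auto
    qed
    then have "(\<integral>\<^sup>+ y. ennreal \<bar>u (x + y) - u y\<bar> \<partial>lborel)
        = (\<integral>\<^sup>+ y. liminf (\<lambda>k. ennreal \<bar>w k (x + y) - w k y\<bar>) \<partial>lborel)"
      by (rule nn_integral_cong_AE)
    also have "\<dots> \<le> liminf (\<lambda>k. \<integral>\<^sup>+ y. ennreal \<bar>w k (x + y) - w k y\<bar> \<partial>lborel)"
      by (rule nn_integral_liminf) measurable
    finally show ?thesis .
  qed
  have "BV_nu_integral \<nu> u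
      \<le> (\<integral>\<^sup>+ x. liminf (\<lambda>k. \<integral>\<^sup>+ y. ennreal \<bar>w k (x + y) - w k y\<bar> \<partial>lborel) \<partial>\<nu>)"
    by (simp add: BV_nu_integral_swap inner nn_integral_mono)
  also have "\<dots> \<le> liminf (\<lambda>k. \<integral>\<^sup>+ x. (\<integral>\<^sup>+ y. ennreal \<bar>w k (x + y) - w k y\<bar> \<partial>lborel) \<partial>\<nu>)"
    by (rule nn_integral_liminf) measurable
  finally show ?thesis
    by (simp add: BV_nu_integral_swap)
qed

lemma BV_nu_integral_rep_cong:
  "L1_rel (rep_L1 U) u \<Longrightarrow> BV_nu_integral \<nu> (rep_L1 U) = BV_nu_integral \<nu> u"
  by (rule BV_nu_integral_cong_AE[OF sets_nu moment zero])

lemma BV_nu_integral_rep_add_le: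
  "BV_nu_integral \<nu> (rep_L1 (U + V)) \<le> BV_nu_integral \<nu> (rep_L1 U) + BV_nu_integral \<nu> (rep_L1 V)"
  by (simp add: BV_nu_integral_rep_cong[OF L1_rel_rep_add] BV_nu_integral_add_le)

lemma BV_nu_integral_rep_scaleR:
  "BV_nu_integral \<nu> (rep_L1 (c *\<^sub>R U)) = ennreal \<bar>c\<bar> * BV_nu_integral \<nu> (rep_L1 U)"
  by (simp add: BV_nu_integral_rep_cong[OF L1_rel_rep_scaleR] BV_nu_integral_scale)

text \<open>Lower semicontinuity in the form that sublevel sets are closed in $L^1$: an a.e.
  convergent subsequence inherits the eventual bound.\<close>

lemma BV_nu_integral_rep_le_of_tendsto:
  assumes "X \<longlonglongrightarrow> U" and bound: "\<forall>\<^sub>F k in sequentially. BV_nu_integral \<nu> (rep_L1 (X k)) \<le> C"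
  shows "BV_nu_integral \<nu> (rep_L1 U) \<le> C"
proof -
  obtain r :: "nat \<Rightarrow> nat" where r: "strict_mono r"
    and ae: "AE x in lborel. (\<lambda>k. rep_L1 (X (r k)) x) \<longlonglongrightarrow> rep_L1 U x"
    using L1_tendsto_AE_subseq[OF assms(1)] by blast
  have "BV_nu_integral \<nu> (rep_L1 U) \<le> liminf (\<lambda>k. BV_nu_integral \<nu> (rep_L1 (X (r k))))"
    by (rule BV_nu_integral_le_liminf[OF _ _ ae]) measurable
  also have "\<dots> \<le> liminf (\<lambda>k. C)"
    using eventually_subseq[OF r bound] by (rule Liminf_mono)
  finally show ?thesis
    by (simp add: Liminf_const)
qed

section \<open>The norm on the space and its completeness\<close>

text \<open>Outside \<open>BV_nu \<nu>\<close> both sides reduce to \<open>norm U\<close>, since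
  \<open>enn2real\<close> sends infinity to 0.\<close>

lemma BV_nu_norm_eq:
  "BV_nu_norm \<nu> U = norm U + enn2real (BV_nu_integral \<nu> (rep_L1 U)) / 2"
proof -
  have "enn2real (1 / 2) = 1 / 2"
    using divide_ennreal[of 1 2] by (metis enn2real_ennreal ennreal_1 ennreal_numeral
        divide_nonneg_pos zero_le_numeral zero_le_one zero_less_numeral)
  then show ?thesis
    by (simp add: BV_nu_norm_def F_nu_def enn2real_mult)
qed

lemma subspace_BV_nu: "subspace (BV_nu \<nu>)"
proof (rule subspaceI)
  \<comment> \<open>Writing 0 as \<open>0 *\<^sub>R 0\<close> puts the factor
    \<open>ennreal 0\<close> in front, so the integral vanishes.\<close>
  show "0 \<in> BV_nu \<nu>"
    using BV_nu_integral_rep_scaleR[of 0 0] by (simp add: BV_nu_def)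
  show "U + V \<in> BV_nu \<nu>" if "U \<in> BV_nu \<nu>" "V \<in> BV_nu \<nu>" for U V
    using that le_less_trans[OF BV_nu_integral_rep_add_le[of U V]] by (simp add: BV_nu_def)
  show "c *\<^sub>R U \<in> BV_nu \<nu>" if "U \<in> BV_nu \<nu>" for c U
    using that by (simp add: BV_nu_def BV_nu_integral_rep_scaleR ennreal_mult_less_top)
qed

text \<open>Definiteness comes from the $L^1$ part alone; the variation part is only a
  seminorm.\<close>

lemma norm_on_BV_nu: "norm_on (BV_nu \<nu>) (BV_nu_norm \<nu>)"
  unfolding norm_on_def
proof (intro conjI ballI allI)
  fix U V :: "'a L1" and c :: real
  assume U: "U \<in> BV_nu \<nu>"
  show "0 \<le> BV_nu_norm \<nu> U"
    by (simp add: BV_nu_norm_eq)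
  show "BV_nu_norm \<nu> U = 0 \<longleftrightarrow> U = 0"
    using BV_nu_integral_rep_scaleR[of 0 0]
    by (auto simp: BV_nu_norm_eq add_nonneg_eq_0_iff)
  show "BV_nu_norm \<nu> (c *\<^sub>R U) = \<bar>c\<bar> * BV_nu_norm \<nu> U"
    by (simp add: BV_nu_norm_eq BV_nu_integral_rep_scaleR enn2real_mult algebra_simps)
  assume V: "V \<in> BV_nu \<nu>"
  \<comment> \<open>Finiteness from \<open>U\<close> and \<open>V\<close> matters here: as
    \<open>enn2real\<close> sends infinity to 0, it is monotone and additive only on finite
    values.\<close>
  have "enn2real (BV_nu_integral \<nu> (rep_L1 (U + V)))
      \<le> enn2real (BV_nu_integral \<nu> (rep_L1 U) + BV_nu_integral \<nu> (rep_L1 V))"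
    using U V by (intro enn2real_mono BV_nu_integral_rep_add_le) (simp add: BV_nu_def)
  also have "\<dots> = enn2real (BV_nu_integral \<nu> (rep_L1 U)) + enn2real (BV_nu_integral \<nu> (rep_L1 V))"
    using U V by (intro enn2real_plus) (auto simp: BV_nu_def)
  finally show "BV_nu_norm \<nu> (U + V) \<le> BV_nu_norm \<nu> U + BV_nu_norm \<nu> V"
    using norm_triangle_ineq[of U V] unfolding BV_nu_norm_eq by argo
qed

lemma complete_norm_on_BV_nu: "complete_norm_on (BV_nu \<nu>) (BV_nu_norm \<nu>)"
  unfolding complete_norm_on_def
proof (intro allI impI)
  fix X :: "nat \<Rightarrow> 'a L1"
  assume X: "\<forall>n. X n \<in> BV_nu \<nu>"
    and cauchy: "\<forall>e>0. \<exists>M. \<forall>m\<ge>M. \<forall>n\<ge>M. BV_nu_norm \<nu> (X m - X n) < e"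
  have norm_le: "norm U \<le> BV_nu_norm \<nu> U" for U
    by (simp add: BV_nu_norm_eq)
  have "Cauchy X"
    by (rule CauchyI) (meson cauchy norm_le le_less_trans)
  then obtain U where U: "X \<longlonglongrightarrow> U"
    using Cauchy_convergent_iff convergent_def by blast
  \<comment> \<open>Semicontinuity is applied in \<open>k\<close> to \<open>X n - X k\<close> with
    \<open>n\<close> fixed. The factor 2 undoes the 1/2 in \<open>F_nu\<close>.\<close>
  have bound: "BV_nu_integral \<nu> (rep_L1 (X n - U)) \<le> ennreal (2 * e)"
    if "\<And>m. m \<ge> M \<Longrightarrow> BV_nu_norm \<nu> (X n - X m) < e" for n M e
  proof (rule BV_nu_integral_rep_le_of_tendsto)
    show "(\<lambda>k. X n - X k) \<longlonglongrightarrow> X n - U"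
      by (intro tendsto_intros U)
    show "\<forall>\<^sub>F k in sequentially. BV_nu_integral \<nu> (rep_L1 (X n - X k)) \<le> ennreal (2 * e)"
      using eventually_ge_at_top[of M]
    proof eventually_elim
      case (elim k)
      \<comment> \<open>Membership excludes an infinite integral, which \<open>enn2real\<close>
        would hide as 0.\<close>
      have "X n - X k \<in> BV_nu \<nu>"
        using X by (intro subspace_diff subspace_BV_nu) auto
      then have fin: "BV_nu_integral \<nu> (rep_L1 (X n - X k)) < \<infinity>"
        by (simp add: BV_nu_def)
      have "enn2real (BV_nu_integral \<nu> (rep_L1 (X n - X k))) / 2 \<le> BV_nu_norm \<nu> (X n - X k)"
        by (simp add: BV_nu_norm_eq)
      then have "enn2real (BV_nu_integral \<nu> (rep_L1 (X n - X k))) \<le> 2 * e"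
        using that[OF elim] by simp
      then have "ennreal (enn2real (BV_nu_integral \<nu> (rep_L1 (X n - X k)))) \<le> ennreal (2 * e)"
        by (rule ennreal_leI)
      then show ?case
        using fin by simp
    qed
  qed
  \<comment> \<open>Any finite threshold would do: once \<open>X M - U\<close> lies in the space, so
    does \<open>U = X M - (X M - U)\<close>.\<close>
  obtain M where M: "\<forall>m\<ge>M. \<forall>n\<ge>M. BV_nu_norm \<nu> (X m - X n) < 1"
    using cauchy zero_less_one by blast
  then have "BV_nu_integral \<nu> (rep_L1 (X M - U)) \<le> ennreal (2 * 1)"
    by (intro bound) auto
  then have "X M - U \<in> BV_nu \<nu>"
    unfolding BV_nu_def using le_less_trans[OF _ ennreal_less_top] by (metis infinity_ennreal_def mem_Collect_eq)
  from subspace_diff[OF subspace_BV_nu X[rule_format, of M] this] have mem: "U \<in> BV_nu \<nu>"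
    by simp
  have "(\<lambda>n. enn2real (BV_nu_integral \<nu> (rep_L1 (X n - U)))) \<longlonglongrightarrow> 0"
  proof (rule LIMSEQ_I)
    fix e :: real assume "0 < e"
    \<comment> \<open>With \<open>e / 4\<close>, the doubled bound is \<open>e / 2\<close>, strictly
      below \<open>e\<close>.\<close>
    then obtain K where K: "\<forall>m\<ge>K. \<forall>n\<ge>K. BV_nu_norm \<nu> (X m - X n) < e / 4"
      using cauchy by (meson divide_pos_pos zero_less_numeral)
    have "enn2real (BV_nu_integral \<nu> (rep_L1 (X n - U))) < e" if "n \<ge> K" for n
    proof -
      have "BV_nu_integral \<nu> (rep_L1 (X n - U)) \<le> ennreal (2 * (e / 4))"
        using K that by (intro bound) auto
      then have "enn2real (BV_nu_integral \<nu> (rep_L1 (X n - U))) \<le> 2 * (e / 4)"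
        using \<open>0 < e\<close> by (intro enn2real_leI) auto
      then show ?thesis
        using \<open>0 < e\<close> by simp
    qed
    then show "\<exists>no. \<forall>n\<ge>no. norm (enn2real (BV_nu_integral \<nu> (rep_L1 (X n - U))) - 0) < e"
      by auto
  qed
  moreover have "(\<lambda>n. norm (X n - U)) \<longlonglongrightarrow> 0"
    using U by (simp add: LIM_zero_iff tendsto_norm_zero_iff)
  ultimately have "(\<lambda>n. norm (X n - U) + enn2real (BV_nu_integral \<nu> (rep_L1 (X n - U))) / 2) \<longlonglongrightarrow> 0"
    by (intro tendsto_add_zero tendsto_divide_zero)
  then show "\<exists>U\<in>BV_nu \<nu>. (\<lambda>n. BV_nu_norm \<nu> (X n - U)) \<longlonglongrightarrow> 0"
    using mem by (auto simp: BV_nu_norm_eq)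
qed

end

theorem lemma2p6:
  fixes \<nu> :: "'a::euclidean_space measure"
  assumes "sets \<nu> = sets borel"
    and "(\<integral>\<^sup>+ x. ennreal (min 1 (norm x)) \<partial>\<nu>) < \<infinity>"
    and "emeasure \<nu> {0} = 0"
  shows "banach_space_on (BV_nu \<nu>) (BV_nu_norm \<nu>)"
  using subspace_BV_nu[OF assms] norm_on_BV_nu[OF assms] complete_norm_on_BV_nu[OF assms]
  by (simp add: banach_space_on_def)

end
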